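(* Let $\mathcal{P}=(P_1,\ldots,P_n)$ be a finite list of partitions (of possibly different integers). If $n\ge 2$, then $\mathcal{P}$ can be extended to the passport of a polynomial. If $n\ge 3$, then $\mathcal{P}$ can be extended to the passport of a rational map.
   Context: A partition $P$ of an integer $d\ge 0$ is a list of positive integers $(p_1,\ldots,p_s)$, order being unimportant and repetitions allowed, with $\sum p_i=d$ (the empty list is a partition of $0$). The trivial partition of $d$ has all parts equal to $1$. If $P=(p_1,\ldots,p_s)$ and $P'=(p_1',\ldots,p_t')$ are partitions of $d$ and $d'$, then $P+P'=(p_1,\ldots,p_s,p_1',\ldots,p_t')$, a partition of $d+d'$. A partition $Q$ extends $P$ if $Q=P+P'$ for some partition $P'$. A list of partitions $\mathcal{Q}$ extends $\mathcal{P}=(P_1,\ldots,P_n)$ if, when suitably ordered, $\mathcal{Q}=(Q_1,\ldots,Q_n)$ and $Q_i$ extends $P_i$ for $i=1,\ldots,n$ (in particular $|\mathcal{Q}|=|\mathcal{P}|=n$). For a rational map $f:\mathbb{P}^1\to\mathbb{P}^1$ of degree $d$ on the Riemann sphere and $y\in\mathbb{P}^1$, $P(f,y)$ denotes the partition of $d$ whose parts are the multiplicities (local degrees) $\operatorname{mult}(f,x)$, $x\in f^{-1}(y)$. The passport of $f$ is the unordered list (repetitions allowed) $\mathcal{P}(f)=(P(f,v_1),\ldots,P(f,v_m))$, where $v_1,\ldots,v_m$ are the distinct critical values of $f$. When $g:\mathbb{C}\to\mathbb{C}$ is a polynomial, its passport $\mathcal{P}(g)$ is defined instead as the list of partitions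 $P(g,v_i)$ with $v_i$ ranging over the finite critical values of $g$ only. *)

theory Defs
  imports
    "HOL-Complex_Analysis.Complex_Analysis"
    "HOL-Computational_Algebra.Polynomial"
    "HOL-Library.Multiset"
begin

section \<open>Partitions\<close>

text \<open>A partition is the multiset of its parts; it is a partition of the integer
  \<open>sum_mset P\<close>, and concatenation of partitions is multiset sum.\<close>

definition is_partition :: "nat multiset \<Rightarrow> bool" where
  "is_partition P \<longleftrightarrow> (\<forall>p\<in>#P. 0 < p)"

definition extends :: "nat multiset \<Rightarrow> nat multiset \<Rightarrow> bool" where
  "extends P Q \<longleftrightarrow> (\<exists>P'. is_partition P' \<and> Q = P + P')"

text \<open>Passports are unordered lists of partitions, i.e. multisets of multisets.\<close>

definition list_extends :: "nat multiset list \<Rightarrow> nat multiset multiset \<Rightarrow> bool" where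
  "list_extends Ps M \<longleftrightarrow> (\<exists>Qs. mset Qs = M \<and> list_all2 extends Ps Qs)"

section \<open>Passports\<close>

text \<open>The following three definitions are relative to a function \<open>\<mu>\<close> giving the
  multiplicities of the map \<open>f\<close> at the points of its domain. Fibres and the set of critical
  values are finite for the maps considered below (\<^const>\<open>mset_set\<close> is empty on
  infinite sets).\<close>

definition fibre_partition :: "('a \<Rightarrow> nat) \<Rightarrow> ('a \<Rightarrow> 'b) \<Rightarrow> 'b \<Rightarrow> nat multiset" where
  "fibre_partition \<mu> f y = image_mset \<mu> (mset_set {x. f x = y})"

definition critical_values :: "('a \<Rightarrow> nat) \<Rightarrow> ('a \<Rightarrow> 'b) \<Rightarrow> 'b set" where
  "critical_values \<mu> f = f ` {x. 2 \<le> \<mu> x}"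

definition passport :: "('a \<Rightarrow> nat) \<Rightarrow> ('a \<Rightarrow> 'b) \<Rightarrow> nat multiset multiset" where
  "passport \<mu> f = image_mset (fibre_partition \<mu> f) (mset_set (critical_values \<mu> f))"

text \<open>Local degree at \<open>x\<close> of a function that is holomorphic and nonconstant near \<open>x\<close>.\<close>

definition local_degree :: "(complex \<Rightarrow> complex) \<Rightarrow> complex \<Rightarrow> nat" where
  "local_degree h x = nat (zorder (\<lambda>z. h z - h x) x)"

text \<open>Only the finite critical values enter here.\<close>

definition poly_passport :: "complex poly \<Rightarrow> nat multiset multiset" where
  "poly_passport g = passport (local_degree (poly g)) (poly g)"

section \<open>Rational maps of the Riemann sphere\<close>

datatype riemann_sphere = Fin complex | Infty

fun sphere_inverse :: "riemann_sphere \<Rightarrow> riemann_sphere" where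
  "sphere_inverse (Fin z) = (if z = 0 then Infty else Fin (inverse z))"
| "sphere_inverse Infty = Fin 0"

text \<open>The affine coordinate; its value at \<^const>\<open>Infty\<close> is irrelevant.\<close>

fun affine_coord :: "riemann_sphere \<Rightarrow> complex" where
  "affine_coord (Fin z) = z"
| "affine_coord Infty = 0"

text \<open>The extension of \<open>p / q\<close> to the sphere, for coprime \<open>p\<close> and \<open>q\<close>. At infinity both
  polynomials are compared in the degree of the map.\<close>

fun quotient_map :: "complex poly \<Rightarrow> complex poly \<Rightarrow> riemann_sphere \<Rightarrow> riemann_sphere" where
  "quotient_map p q (Fin z) =
     (if poly q z = 0 then Infty else Fin (poly p z / poly q z))"
| "quotient_map p q Infty =
     (let d = max (degree p) (degree q)
      in if coeff q d = 0 then Infty else Fin (coeff p d / coeff q d))"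

definition rational_map :: "(riemann_sphere \<Rightarrow> riemann_sphere) \<Rightarrow> bool" where
  "rational_map f \<longleftrightarrow>
     (\<exists>p q. coprime p q \<and> 1 \<le> max (degree p) (degree q) \<and> f = quotient_map p q)"

text \<open>Local degrees are computed in the coordinate \<open>z\<close> at finite points and \<open>1/z\<close> at
  infinity, both in the source and in the target.\<close>

fun mult :: "(riemann_sphere \<Rightarrow> riemann_sphere) \<Rightarrow> riemann_sphere \<Rightarrow> nat" where
  "mult f (Fin x) =
     (if f (Fin x) = Infty
      then local_degree (\<lambda>z. affine_coord (sphere_inverse (f (Fin z)))) x
      else local_degree (\<lambda>z. affine_coord (f (Fin z))) x)"
| "mult f Infty =
     (if f Infty = Infty
      then local_degree (\<lambda>z. affine_coord (sphere_inverse (f (sphere_inverse (Fin z))))) 0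
      else local_degree (\<lambda>z. affine_coord (f (sphere_inverse (Fin z)))) 0)"

definition rational_passport ::
  "(riemann_sphere \<Rightarrow> riemann_sphere) \<Rightarrow> nat multiset multiset" where
  "rational_passport f = passport (mult f) f"

end

theory Submission
  imports Defs "HOL-Computational_Algebra.Fundamental_Theorem_Algebra"
begin

text \<open>The proof is a composition argument. Let \<open>g\<close> and \<open>h\<close> be polynomials. The critical values of
  \<open>g \<circ> h\<close> are those of \<open>g\<close> together with the images under \<open>g\<close> of those of \<open>h\<close>, and local degrees
  multiply. Suppose that \<open>g\<close> is branched only over points \<open>w\<^sub>1, \<dots>, w\<^sub>n\<close> and that every \<open>w\<^sub>i\<close> has
  an unramified preimage \<open>e\<^sub>i\<close>. If \<open>h\<close> is branched only over \<open>e\<^sub>1, \<dots>, e\<^sub>n\<close>, then \<open>g \<circ> h\<close> is again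
  branched only over the \<open>w\<^sub>i\<close>, and its fibre over \<open>w\<^sub>i\<close> contains the fibre of \<open>h\<close> over \<open>e\<^sub>i\<close> and,
  above each other point of the fibre of \<open>g\<close>, a point at which \<open>h\<close> is unramified. So the parts
  prescribed for \<open>g\<close> and those prescribed for \<open>h\<close> both occur. An unramified preimage of \<open>w\<^sub>i\<close>
  is used up each time, but \<open>h\<close> supplies a new one.

  This makes the prescribable lists closed under addition (\<open>realizable_add\<close>), provided that one
  asks for a polynomial at every position of the \<open>n\<close> points, since the \<open>e\<^sub>i\<close> are not under control.
  It remains to prescribe a single part \<open>p\<close> over one point (\<open>realizable_single\<close>). An affine image
  of \<open>x\<^sup>p (1 - x)\<close> with \<open>p \<ge> 2\<close> has only two critical values, and these can be moved to any two
  points; this is where \<open>n \<ge> 2\<close> enters. A part 1 comes from the case \<open>p = 3\<close>.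
  Adding a part 2 to every prescribed partition finally forces each \<open>w\<^sub>i\<close> to be a critical value.

  For rational maps, compose once more on the left with
  \<open>R(x) = x\<^sup>3 (x - 2) / (1 - 2 x)\<close>. All its fibres over its critical values \<open>0\<close>, \<open>1\<close>, \<open>\<infinity>\<close> have the
  form \<open>3 + 1\<close>, with triple points \<open>0\<close>, \<open>1\<close>, \<open>\<infinity>\<close> and unramified points \<open>2\<close>, \<open>-1\<close>, \<open>1/2\<close>. Place the
  critical values of the polynomial \<open>g\<close> at these three unramified points and at further points over
  other values of \<open>R\<close>. Then the fibres of \<open>g\<close> over its critical values occur with
  unchanged multiplicities in the fibres of \<open>R \<circ> g\<close>, and the total
  ramification of \<open>g\<close> at infinity only affects the fibre over \<open>\<infinity> = R(1/2)\<close>, which is one of the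
  allowed values. Three values are needed to accommodate \<open>0\<close>, \<open>1\<close> and \<open>\<infinity>\<close>.\<close>

section \<open>Local degrees\<close>

lemma local_degree_compose:
  assumes "g analytic_on {x}" "\<forall>\<^sub>F z in at x. g z \<noteq> g x"
  assumes "f analytic_on {g x}" "\<forall>\<^sub>F w in at (g x). f w \<noteq> f (g x)"
  shows "local_degree (\<lambda>z. f (g z)) x = local_degree f (g x) * local_degree g x"
proof -
  let ?f = "\<lambda>w. f w - f (g x)"
  have an: "?f analytic_on {g x}"
    using assms(3) by (intro analytic_intros)
  have nz: "\<forall>\<^sub>F w in at (g x). ?f w \<noteq> 0"
    using assms(4) by simp
  have "zorder (?f \<circ> g) x = zorder ?f (g x) * zorder (\<lambda>z. g z - g x) x"
    using an nz assms(1,2)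
    by (intro zorder_compose' isolated_singularity_at_analytic not_essential_analytic)
  moreover have "0 \<le> zorder ?f (g x)"
    using an nz by (intro zorder_ge_0 eventually_frequently) auto
  ultimately show ?thesis
    by (simp add: local_degree_def o_def nat_mult_distrib)
qed

lemma local_degree_pos:
  assumes "f analytic_on {x}" "\<forall>\<^sub>F z in at x. f z \<noteq> f x"
  shows "0 < local_degree f x"
proof -
  have "zorder (\<lambda>z. f z - f x) x > 0 \<longleftrightarrow> f x - f x = 0"
    using assms by (intro zorder_pos_iff' analytic_intros eventually_frequently) auto
  then show ?thesis
    by (simp add: local_degree_def)
qed

lemma local_degree_eq_1:
  assumes "f analytic_on {x}" "(f has_field_derivative d) (at x)" "d \<noteq> 0"
  shows "local_degree f x = 1"
proof -
  have "((\<lambda>z. f z - f x) has_field_derivative d) (at x)"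
    using assms(2) by (auto intro!: derivative_eq_intros)
  then have "deriv (\<lambda>z. f z - f x) x \<noteq> 0"
    using assms(3) by (simp add: DERIV_imp_deriv)
  then have "zorder (\<lambda>z. f z - f x) x = 1"
    using assms(1) by (intro zorder_zero_eqI' analytic_intros) auto
  then show ?thesis
    by (simp add: local_degree_def)
qed

lemma analytic_on_poly: "poly p analytic_on S"
proof -
  have "poly p holomorphic_on UNIV"
    by (auto simp: holomorphic_on_def field_differentiable_def intro: poly_DERIV)
  then show ?thesis
    using analytic_on_open analytic_on_subset open_UNIV subset_UNIV by blast
qed

lemma finite_poly_fibre:
  fixes p :: "complex poly"
  assumes "1 \<le> degree p"
  shows "finite {x. poly p x = y}"
proof -
  have "p - [:y:] \<noteq> 0"
    using assms by auto
  then have "finite {x. poly (p - [:y:]) x = 0}"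
    by (rule poly_roots_finite)
  then show ?thesis by simp
qed

lemma poly_surj:
  fixes p :: "complex poly"
  assumes "1 \<le> degree p"
  obtains x where "poly p x = y"
proof -
  have "degree (p + [:- y:]) = degree p"
    using assms by (intro degree_add_eq_left) simp
  then have "\<not> constant (poly (p + [:- y:]))"
    using assms constant_degree[of "p + [:- y:]"] by simp
  then obtain x where "poly (p + [:- y:]) x = 0"
    using fundamental_theorem_of_algebra by blast
  then show ?thesis
    using that[of x] by simp
qed

lemma eventually_at_not_in_finite:
  fixes x :: "'a::t1_space"
  assumes "finite S"
  shows "\<forall>\<^sub>F z in at x. z \<notin> S"
proof -
  have "closed (S - {x})"
    using assms by (intro finite_imp_closed) auto
  then have "\<forall>\<^sub>F z in nhds x. z \<in> - (S - {x})"
    by (intro eventually_nhds_in_open open_Compl) auto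
  then show ?thesis
    unfolding eventually_at_filter by eventually_elim auto
qed

lemma poly_locally_nonconstant:
  fixes p :: "complex poly"
  assumes "1 \<le> degree p"
  shows "\<forall>\<^sub>F z in at x. poly p z \<noteq> poly p x"
  using eventually_at_not_in_finite[OF finite_poly_fibre[OF assms, of "poly p x"], of x] by simp

lemma poly_local_degree_pos:
  "1 \<le> degree p \<Longrightarrow> 0 < local_degree (poly p) x"
  by (intro local_degree_pos analytic_on_poly poly_locally_nonconstant)

lemma poly_local_degree_eq_1:
  "poly (pderiv p) x \<noteq> 0 \<Longrightarrow> local_degree (poly p) x = 1"
  by (rule local_degree_eq_1[OF analytic_on_poly poly_DERIV])

lemma poly_local_degree_compose:
  assumes "1 \<le> degree g" "1 \<le> degree h"
  shows "local_degree (poly (pcompose g h)) x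
       = local_degree (poly g) (poly h x) * local_degree (poly h) x"
proof -
  have "poly (pcompose g h) = (\<lambda>z. poly g (poly h z))"
    by (simp add: fun_eq_iff poly_pcompose)
  then show ?thesis
    using assms by (simp add: local_degree_compose analytic_on_poly poly_locally_nonconstant)
qed

section \<open>Fibres\<close>

lemma image_mset_set_mono:
  assumes "finite T" "S \<subseteq> T"
  shows "image_mset f (mset_set S) \<subseteq># image_mset f (mset_set T)"
  using assms by (simp add: image_mset_subseteq_mono subset_imp_msubset_mset_set)

lemma mem_fibre_partitionE:
  assumes "p \<in># fibre_partition \<mu> f y"
  obtains x where "f x = y" "\<mu> x = p"
proof -
  from assms obtain x where "x \<in># mset_set {x. f x = y}" "\<mu> x = p"
    unfolding fibre_partition_def by auto
  moreover from this have "finite {x. f x = y}"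
    using not_in_iff by fastforce
  ultimately show ?thesis
    using that[of x] by simp
qed

text \<open>Above \<open>e\<close> the multiplicities of \<open>h\<close> are unchanged because \<open>\<mu> e = 1\<close>. Above any other point
  \<open>y\<close> of the fibre of \<open>g\<close> choose one point where \<open>h\<close> is unramified: its multiplicity is \<open>\<mu> y\<close>.
  The summand 1 in the bound for \<open>g\<close> accounts for \<open>e\<close>, which the fibre over it replaces.\<close>
lemma subseteq_fibre_partition_compose:
  assumes fin: "finite {x. g x = w}" "finite {x. g (h x) = w}"
  assumes e: "g e = w" "\<mu> e = 1"
  assumes \<kappa>: "\<And>x. \<kappa> x = \<mu> (h x) * \<nu> x"
  assumes unram: "\<And>y. g y = w \<Longrightarrow> y \<noteq> e \<Longrightarrow> \<exists>x. h x = y \<and> \<nu> x = 1"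
  assumes A: "add_mset 1 A \<subseteq># fibre_partition \<mu> g w"
  assumes B: "C \<subseteq># fibre_partition \<nu> h e"
  shows "A + C \<subseteq># fibre_partition \<kappa> (\<lambda>x. g (h x)) w"
proof -
  define F where "F = {y. g y = w} - {e}"
  have "\<forall>y\<in>F. \<exists>x. h x = y \<and> \<nu> x = 1"
    using unram by (auto simp: F_def)
  then obtain s where s: "\<And>y. y \<in> F \<Longrightarrow> h (s y) = y \<and> \<nu> (s y) = 1"
    by metis
  have inj: "inj_on s F"
    by (metis inj_onI s)
  have fib: "{y. g y = w} = insert e F" and "finite F" "e \<notin> F"
    using fin e by (auto simp: F_def)
  then have "A \<subseteq># image_mset \<mu> (mset_set F)"
    using A e(2) by (simp add: fibre_partition_def)
  also have "image_mset \<mu> (mset_set F) = image_mset \<kappa> (mset_set (s ` F))"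
    unfolding image_mset_mset_set[OF inj, symmetric] multiset.map_comp
    using \<open>finite F\<close> s by (intro image_mset_cong) (simp add: \<kappa>)
  finally have 1: "A \<subseteq># image_mset \<kappa> (mset_set (s ` F))" .
  let ?H = "{x. h x = e}"
  have "finite ?H"
    by (rule finite_subset[OF _ fin(2)]) (use e in auto)
  have "C \<subseteq># image_mset \<kappa> (mset_set ?H)"
  proof -
    have "image_mset \<nu> (mset_set ?H) = image_mset \<kappa> (mset_set ?H)"
      using e(2) \<open>finite ?H\<close> by (intro image_mset_cong) (simp add: \<kappa>)
    then show ?thesis
      using B by (simp add: fibre_partition_def)
  qed
  with 1 have "A + C \<subseteq># image_mset \<kappa> (mset_set (s ` F \<union> ?H))"
    using \<open>finite F\<close> \<open>finite ?H\<close> s \<open>e \<notin> F\<close>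
    by (subst mset_set_Union) (auto intro: subset_mset.add_mono)
  also have "\<dots> \<subseteq># image_mset \<kappa> (mset_set {x. g (h x) = w})"
    using fin(2) s e(1) by (intro image_mset_set_mono) (auto simp: F_def)
  finally show ?thesis
    by (simp add: fibre_partition_def)
qed

section \<open>Realizable configurations\<close>

text \<open>The positions \<open>w\<close> are arbitrary because in a composition the inner polynomial has to be
  branched over preimages that the outer one dictates. The additional part 1 is the unramified
  preimage over which the next composition takes place. The points of \<open>w ` I\<close> need not
  all be critical values, which lets the identity polynomial serve as the neutral element.\<close>
definition realizable :: "'i set \<Rightarrow> ('i \<Rightarrow> nat multiset) \<Rightarrow> bool" where
  "realizable I A \<longleftrightarrow>
     (\<forall>w :: 'i \<Rightarrow> complex. inj_on w I \<longrightarrow>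
       (\<exists>g. 1 \<le> degree g
          \<and> critical_values (local_degree (poly g)) (poly g) \<subseteq> w ` I
          \<and> (\<forall>i\<in>I. add_mset 1 (A i) \<subseteq># fibre_partition (local_degree (poly g)) (poly g) (w i))))"

lemma realizable_cong: "(\<And>i. i \<in> I \<Longrightarrow> A i = B i) \<Longrightarrow> realizable I A \<longleftrightarrow> realizable I B"
  by (simp add: realizable_def)

lemma realizable_empty: "realizable I (\<lambda>_. {#})"
  unfolding realizable_def
proof (intro allI impI)
  fix w :: "'a \<Rightarrow> complex"
  let ?g = "[:0, 1:] :: complex poly"
  have 1: "local_degree (poly ?g) = (\<lambda>_. 1)"
    by (intro ext poly_local_degree_eq_1) (simp add: pderiv_pCons)
  have "fibre_partition (local_degree (poly ?g)) (poly ?g) y = {#1#}" for y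
    by (simp only: fibre_partition_def 1) simp
  moreover have "critical_values (local_degree (poly ?g)) (poly ?g) = {}"
    by (simp only: critical_values_def 1) simp
  ultimately show "\<exists>g. 1 \<le> degree g
      \<and> critical_values (local_degree (poly g)) (poly g) \<subseteq> w ` I
      \<and> (\<forall>i\<in>I. add_mset 1 {#} \<subseteq># fibre_partition (local_degree (poly g)) (poly g) (w i))"
    by (intro exI[of _ ?g]) auto
qed

text \<open>Realize \<open>A\<close> by \<open>g\<close> over the points \<open>w i\<close>, choose an unramified preimage \<open>e i\<close> of each, realize
  \<open>B\<close> by \<open>h\<close> over the points \<open>e i\<close>, and take \<open>g \<circ> h\<close>.\<close>
lemma realizable_add:
  assumes "realizable I A" "realizable I B"
  shows "realizable I (\<lambda>i. A i + B i)"
  unfolding realizable_def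
proof (intro allI impI)
  fix w :: "'a \<Rightarrow> complex"
  assume w: "inj_on w I"
  from assms(1) w obtain g where g: "1 \<le> degree g"
    and gcv: "critical_values (local_degree (poly g)) (poly g) \<subseteq> w ` I"
    and gfib: "\<And>i. i \<in> I \<Longrightarrow>
      add_mset 1 (A i) \<subseteq># fibre_partition (local_degree (poly g)) (poly g) (w i)"
    unfolding realizable_def by blast
  have "\<exists>x. poly g x = w i \<and> local_degree (poly g) x = 1" if "i \<in> I" for i
    using mset_subset_eqD[OF gfib[OF that], of 1] by (auto elim: mem_fibre_partitionE)
  then obtain e where e: "\<And>i. i \<in> I \<Longrightarrow> poly g (e i) = w i"
    and e1: "\<And>i. i \<in> I \<Longrightarrow> local_degree (poly g) (e i) = 1"
    by metis
  have "inj_on e I"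
    by (metis e inj_on_def w)
  with assms(2) obtain h where h: "1 \<le> degree h"
    and hcv: "critical_values (local_degree (poly h)) (poly h) \<subseteq> e ` I"
    and hfib: "\<And>i. i \<in> I \<Longrightarrow>
      add_mset 1 (B i) \<subseteq># fibre_partition (local_degree (poly h)) (poly h) (e i)"
    unfolding realizable_def by blast
  let ?f = "pcompose g h"
  have deg: "1 \<le> degree ?f"
    using g h by (simp add: degree_pcompose)
  have f: "poly ?f = (\<lambda>x. poly g (poly h x))"
    by (simp add: fun_eq_iff poly_pcompose)
  note ld = poly_local_degree_compose[OF g h]
  have "critical_values (local_degree (poly ?f)) (poly ?f) \<subseteq> w ` I"
  proof (clarsimp simp: critical_values_def)
    fix x assume "2 \<le> local_degree (poly ?f) x"
    then have "2 \<le> local_degree (poly g) (poly h x) \<or> 2 \<le> local_degree (poly h) x"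
      unfolding ld using mult_le_mono[of "local_degree (poly g) (poly h x)" 1
          "local_degree (poly h) x" 1] by (metis not_less_eq_eq numeral_2_eq_2 One_nat_def mult_1)
    then show "poly ?f x \<in> w ` I"
    proof
      assume "2 \<le> local_degree (poly g) (poly h x)"
      then show ?thesis
        using gcv by (auto simp: critical_values_def poly_pcompose)
    next
      assume "2 \<le> local_degree (poly h) x"
      then show ?thesis
        using hcv e by (force simp: critical_values_def poly_pcompose)
    qed
  qed
  moreover have "add_mset 1 (A i + B i)
      \<subseteq># fibre_partition (local_degree (poly ?f)) (poly ?f) (w i)" if i: "i \<in> I" for i
  proof -
    \<comment> \<open>The fibre of \<open>g\<close> over \<open>w i\<close> meets the branch points \<open>e ` I\<close> of \<open>h\<close> in \<open>e i\<close> alone, because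
      the points \<open>e j\<close> lie over distinct values.\<close>
    have unram: "\<exists>x. poly h x = y \<and> local_degree (poly h) x = 1"
      if y: "poly g y = w i" "y \<noteq> e i" for y
    proof -
      obtain x where x: "poly h x = y"
        using poly_surj[OF h] by blast
      have "y \<notin> e ` I"
        using y i e w by (auto dest: inj_onD)
      with x hcv have "\<not> 2 \<le> local_degree (poly h) x"
        by (auto simp: critical_values_def)
      moreover have "0 < local_degree (poly h) x"
        by (rule poly_local_degree_pos[OF h])
      ultimately show ?thesis
        using x by (intro exI[of _ x]) auto
    qed
    have "A i + add_mset 1 (B i)
      \<subseteq># fibre_partition (local_degree (poly ?f)) (\<lambda>x. poly g (poly h x)) (w i)"
      by (rule subseteq_fibre_partition_compose[where e = "e i"
            and \<mu> = "local_degree (poly g)" and \<nu> = "local_degree (poly h)"])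
        (use finite_poly_fibre[OF g] finite_poly_fibre[OF deg] e e1 i ld unram gfib hfib
          in \<open>auto simp: poly_pcompose\<close>)
    then show ?thesis
      by (simp add: f)
  qed
  ultimately show "\<exists>g. 1 \<le> degree g
      \<and> critical_values (local_degree (poly g)) (poly g) \<subseteq> w ` I
      \<and> (\<forall>i\<in>I. add_mset 1 (A i + B i)
           \<subseteq># fibre_partition (local_degree (poly g)) (poly g) (w i))"
    using deg by blast
qed

section \<open>The building blocks\<close>

text \<open>A polynomial \<open>c (x - \<rho>)\<^sup>d\<close> has no critical point other than \<open>\<rho>\<close>, so a critical point at \<open>0\<close>
  rules out that \<open>\<rho>\<close> is the only root. Applied to a shifted block below, this produces
  an unramified point over its second critical value.\<close>
lemma poly_other_root:
  fixes q :: "complex poly"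
  assumes "1 \<le> degree q" "poly (pderiv q) 0 = 0" "\<rho> \<noteq> 0"
  obtains y where "poly q y = 0" "y \<noteq> \<rho>"
proof (rule ccontr)
  assume "\<not> thesis"
  then have only: "y = \<rho>" if "poly q y = 0" for y
    using that \<open>\<And>y. poly q y = 0 \<Longrightarrow> y \<noteq> \<rho> \<Longrightarrow> thesis\<close> by blast
  have "q \<noteq> 0"
    using assms(1) by auto
  obtain R where R: "size R = degree q" "q = smult (lead_coeff q) (\<Prod>x\<in>#R. [:- x, 1:])"
    using alg_closed_imp_factorization[OF \<open>q \<noteq> 0\<close>] by blast
  have "x = \<rho>" if "x \<in># R" for x
  proof (rule only)
    have "poly (\<Prod>x\<in>#R. [:- x, 1:]) x = 0"
      using that by (auto simp: poly_prod_mset prod_mset_zero_iff)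
    then show "poly q x = 0"
      by (subst R(2)) simp
  qed
  then have "R = replicate_mset (degree q) \<rho>"
    using R(1) by (metis set_mset_subset_singletonD singletonI subsetI)
  moreover obtain k where k: "degree q = Suc k"
    using assms(1) by (cases "degree q") auto
  ultimately have "q = smult (lead_coeff q) ([:- \<rho>, 1:] ^ Suc k)"
    using R(2) by simp
  then have "poly (pderiv q) 0
      = poly (pderiv (smult (lead_coeff q) ([:- \<rho>, 1:] ^ Suc k))) 0"
    by (rule arg_cong)
  then have "poly (pderiv q) 0 = lead_coeff q * of_nat (Suc k) * (- \<rho>) ^ k"
    by (simp add: pderiv_smult pderiv_power_Suc pderiv_pCons del: power_Suc)
  then show False
    using assms(2,3) \<open>q \<noteq> 0\<close> by (simp del: of_nat_Suc)
qed

text \<open>For \<open>p \<ge> 2\<close> the polynomial \<open>x\<^sup>p (1 - x)\<close> has the critical points \<open>0\<close> and \<open>p / (p + 1)\<close>. The affine change of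
  coordinates in the target sends the critical value \<open>0\<close> to \<open>a\<close> and the other one,
  \<open>p\<^sup>p / (p + 1)\<^sup>p\<^sup>+\<^sup>1\<close>, to \<open>b\<close>.\<close>
definition block :: "nat \<Rightarrow> complex \<Rightarrow> complex \<Rightarrow> complex poly" where
  "block p a b = [:a:] + smult ((b - a) * of_nat (Suc p) ^ Suc p / of_nat p ^ p)
                           (monom 1 p - monom 1 (Suc p))"

lemma poly_block:
  "poly (block p a b) x
     = a + (b - a) * of_nat (Suc p) ^ Suc p / of_nat p ^ p * (x ^ p * (1 - x))"
  by (simp add: block_def poly_monom algebra_simps)

lemma poly_pderiv_block:
  assumes "2 \<le> p"
  shows "poly (pderiv (block p a b)) x
     = (b - a) * of_nat (Suc p) ^ Suc p / of_nat p ^ p * x ^ (p - 1) * (of_nat p - of_nat (Suc p) * x)"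
proof -
  obtain k where p: "p = Suc k"
    using assms by (cases p) auto
  show ?thesis
    by (simp add: p block_def pderiv_add pderiv_smult pderiv_diff pderiv_monom pderiv_pCons
        poly_monom del: of_nat_Suc) (simp add: algebra_simps)
qed

lemma degree_block:
  assumes "a \<noteq> b"
  shows "degree (block p a b) = Suc p"
proof -
  have "degree (monom 1 p - monom 1 (Suc p) :: complex poly) = Suc p"
    unfolding diff_conv_add_uminus
    by (subst degree_add_eq_right) (simp_all add: degree_monom_eq)
  moreover have "(b - a) * of_nat (Suc p) ^ Suc p / of_nat p ^ p \<noteq> (0::complex)"
    using assms by (cases "p = 0") (simp_all del: of_nat_Suc)
  ultimately have "degree (smult ((b - a) * of_nat (Suc p) ^ Suc p / of_nat p ^ p)
      (monom 1 p - monom 1 (Suc p) :: complex poly)) = Suc p"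
    by simp
  then show ?thesis
    unfolding block_def by (subst degree_add_eq_right) simp_all
qed

lemma poly_block_critical_point:
  assumes "2 \<le> p"
  shows "poly (block p a b) (of_nat p / of_nat (Suc p)) = b"
proof -
  have 1: "1 - of_nat p / of_nat (Suc p) = (1 / of_nat (Suc p) :: complex)"
    by (simp add: divide_simps del: of_nat_Suc) simp
  show ?thesis
    unfolding poly_block 1 using assms by (simp add: power_divide field_simps del: of_nat_Suc)
qed

lemma local_degree_block_unramified:
  assumes "2 \<le> p" "a \<noteq> b" "x \<noteq> 0" "x \<noteq> of_nat p / of_nat (Suc p)"
  shows "local_degree (poly (block p a b)) x = 1"
proof (rule poly_local_degree_eq_1)
  have "of_nat (Suc p) * x \<noteq> of_nat p"
    using assms(4) by (simp add: field_simps del: of_nat_Suc)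
  then show "poly (pderiv (block p a b)) x \<noteq> 0"
    using assms by (simp add: poly_pderiv_block del: of_nat_Suc)
qed

lemma local_degree_block_0:
  assumes "2 \<le> p" "a \<noteq> b"
  shows "local_degree (poly (block p a b)) 0 = p"
proof -
  let ?c = "(b - a) * of_nat (Suc p) ^ Suc p / of_nat p ^ p"
  have "zorder (\<lambda>z. poly (block p a b) z - poly (block p a b) 0) 0 = int p"
  proof (rule zorder_eqI)
    show "(\<lambda>z. ?c * (1 - z)) holomorphic_on UNIV"
      by (intro holomorphic_intros)
    show "?c * (1 - 0) \<noteq> 0"
      using assms by (simp del: of_nat_Suc)
    show "poly (block p a b) w - poly (block p a b) 0 = ?c * (1 - w) * (w - 0) powi int p" for w
      using assms(1) by (simp add: poly_block power_0_left del: of_nat_Suc power_Suc)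
  qed auto
  then show ?thesis
    by (simp add: local_degree_def)
qed

lemma critical_values_block:
  assumes "2 \<le> p" "a \<noteq> b"
  shows "critical_values (local_degree (poly (block p a b))) (poly (block p a b)) \<subseteq> {a, b}"
proof -
  have "poly (block p a b) x \<in> {a, b}" if "2 \<le> local_degree (poly (block p a b)) x" for x
  proof (cases "x = 0")
    case True
    then show ?thesis using assms(1) by (simp add: poly_block)
  next
    case False
    then have "x = of_nat p / of_nat (Suc p)"
      using local_degree_block_unramified[OF assms False] that by fastforce
    then show ?thesis
      using poly_block_critical_point[OF assms(1)] by simp
  qed
  then show ?thesis
    by (auto simp: critical_values_def)
qed

lemma pair_subseteq_fibre_partition:
  assumes "finite {x. f x = v}" "f x = v" "f y = v" "x \<noteq> y"
  shows "{#\<mu> x, \<mu> y#} \<subseteq># fibre_partition \<mu> f v"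
proof -
  have "image_mset \<mu> (mset_set {x, y}) \<subseteq># image_mset \<mu> (mset_set {x. f x = v})"
    using assms by (intro image_mset_set_mono) auto
  then show ?thesis
    using assms(4) by (simp add: fibre_partition_def add_mset_commute)
qed

lemma mem_fibre_partition:
  assumes "finite {x. f x = v}" "f x = v"
  shows "\<mu> x \<in># fibre_partition \<mu> f v"
  using assms by (auto simp: fibre_partition_def)

text \<open>Over \<open>a\<close> lie \<open>0\<close>, with multiplicity \<open>p\<close>, and the simple point \<open>1\<close>. Over \<open>b\<close> the only ramified
  point is \<open>p / (p + 1)\<close>, and it is not alone in its fibre.\<close>
lemma block_for_ramified_part:
  assumes "2 \<le> p" "a \<noteq> b"
  shows "{#p, 1#} \<subseteq># fibre_partition (local_degree (poly (block p a b))) (poly (block p a b)) a"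
    and "1 \<in># fibre_partition (local_degree (poly (block p a b))) (poly (block p a b)) b"
proof -
  let ?h = "block p a b"
  let ?\<rho> = "of_nat p / of_nat (Suc p) :: complex"
  note fin = finite_poly_fibre[of ?h]
  have deg: "1 \<le> degree ?h"
    using assms by (simp add: degree_block)
  have at_0: "poly ?h 0 = a" and at_1: "poly ?h 1 = a"
    using assms(1) by (simp_all add: poly_block)
  have "local_degree (poly ?h) 1 = 1"
    using assms by (intro local_degree_block_unramified) (auto simp: field_simps)
  then show "{#p, 1#} \<subseteq># fibre_partition (local_degree (poly ?h)) (poly ?h) a"
    using pair_subseteq_fibre_partition[OF fin[OF deg] at_0 at_1, of "local_degree (poly ?h)"]
      local_degree_block_0[OF assms] by simp
  have "degree ([:- b:] + ?h) = degree ?h"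
    using deg by (intro degree_add_eq_right) simp
  moreover have "poly (pderiv ([:- b:] + ?h)) 0 = 0"
    using assms(1) by (simp add: pderiv_add poly_pderiv_block pderiv_pCons)
  ultimately obtain y where y: "poly ([:- b:] + ?h) y = 0" "y \<noteq> ?\<rho>"
    using poly_other_root[of "[:- b:] + ?h" ?\<rho>] deg assms(1) by (auto simp del: of_nat_Suc)
  then have "poly ?h y = b"
    by simp
  moreover from this have "y \<noteq> 0"
    using assms(2) at_0 by auto
  ultimately show "1 \<in># fibre_partition (local_degree (poly ?h)) (poly ?h) b"
    using mem_fibre_partition[of "poly ?h" b y "local_degree (poly ?h)"] fin[OF deg]
      local_degree_block_unramified[OF assms _ y(2)] by simp
qed

text \<open>Prescribing a part 1 takes two unramified points over the same value, one of them to be kept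
  for later compositions. The quartic block has two such points
  over its second critical value:
  \<open>256 x\<^sup>4 - 256 x\<^sup>3 + 27 = (4 x - 3)\<^sup>2 (16 x\<^sup>2 + 8 x + 3)\<close>, and the last factor has the roots
  \<open>(- 1 \<plusminus> \<i> \<surd>2) / 4\<close>.\<close>
lemma block_for_unramified_part:
  assumes "a \<noteq> b"
  shows "{#1, 1#} \<subseteq># fibre_partition (local_degree (poly (block 3 a b))) (poly (block 3 a b)) b"
proof -
  let ?h = "block 3 a b"
  define s where "s = \<i> * of_real (sqrt 2)"
  have s2: "s * s = - 2"
    by (simp add: s_def complex_eq_iff)
  have unram: "poly ?h ((t - 1) / 4) = b \<and> local_degree (poly ?h) ((t - 1) / 4) = 1"
    if t: "t * t = - 2" for t :: complex
  proof -
    have "256 / 27 * (((t - 1) / 4) ^ 3 * (1 - (t - 1) / 4)) = 1"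
    proof -
      have "256 / 27 * (((t - 1) / 4) ^ 3 * (1 - (t - 1) / 4)) = (t - 1) ^ 3 * (5 - t) / 27"
        by (simp add: field_simps)
      also have "(t - 1) ^ 3 * (5 - t) = 27"
        using t by algebra
      finally show ?thesis by simp
    qed
    moreover have "poly ?h x = a + (b - a) * (256 / 27 * (x ^ 3 * (1 - x)))" for x
      by (simp add: poly_block eval_nat_numeral algebra_simps)
    ultimately have "poly ?h ((t - 1) / 4) = b"
      by (simp only:) simp
    moreover have "t \<noteq> 1" "t \<noteq> 4"
      using t by auto
    then have "local_degree (poly ?h) ((t - 1) / 4) = 1"
      using assms by (intro local_degree_block_unramified) (auto simp: field_simps)
    ultimately show ?thesis by blast
  qed
  have "s \<noteq> 0"
    using s2 by auto
  have "finite {x. poly ?h x = b}"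
    using assms by (intro finite_poly_fibre) (simp add: degree_block)
  then show ?thesis
    using pair_subseteq_fibre_partition[of "poly ?h" b "(s - 1) / 4" "(- s - 1) / 4"
        "local_degree (poly ?h)"] unram[of s] unram[of "- s"] s2 \<open>s \<noteq> 0\<close>
    by auto
qed

text \<open>Take a block branched over \<open>w i\<close> and one other point \<open>w j\<close>. For \<open>p = 1\<close> the roles of the two
  critical values are exchanged, so that the two unramified points lie over \<open>w i\<close>.\<close>
lemma realizable_single:
  assumes "finite I" "2 \<le> card I" "i \<in> I" "0 < p"
  shows "realizable I (\<lambda>k. if k = i then {#p#} else {#})"
  unfolding realizable_def
proof (intro allI impI)
  fix w :: "'a \<Rightarrow> complex"
  assume w: "inj_on w I"
  have "I \<noteq> {i}"
    using assms(2) by auto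
  then obtain j where j: "j \<in> I" "j \<noteq> i"
    using assms(3) by blast
  define h where "h = (if p = 1 then block 3 (w j) (w i) else block p (w i) (w j))"
  let ?\<Phi> = "fibre_partition (local_degree (poly h)) (poly h)"
  have ne: "w i \<noteq> w j" "w j \<noteq> w i"
    using inj_onD[OF w] assms(3) j by auto
  have deg: "1 \<le> degree h"
    using ne by (simp add: h_def degree_block)
  have cv: "critical_values (local_degree (poly h)) (poly h) \<subseteq> {w i, w j}"
    using critical_values_block[OF _ ne(1), of p] critical_values_block[OF _ ne(2), of 3] assms(4)
    by (auto simp: h_def)
  have at_i: "add_mset 1 {#p#} \<subseteq># ?\<Phi> (w i)"
    using block_for_ramified_part(1)[OF _ ne(1), of p] block_for_unramified_part[OF ne(2)] assms(4)
    by (auto simp: h_def add_mset_commute)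
  have at_j: "1 \<in># ?\<Phi> (w j)"
    using block_for_ramified_part(2)[OF _ ne(1), of p]
      mset_subset_eqD[OF block_for_ramified_part(1)[OF _ ne(2), of 3], of 1] assms(4)
    by (auto simp: h_def)
  have elsewhere: "1 \<in># ?\<Phi> (w k)" if k: "k \<in> I" "k \<noteq> i" "k \<noteq> j" for k
  proof -
    obtain x where x: "poly h x = w k"
      using poly_surj[OF deg] by blast
    have "w k \<notin> {w i, w j}"
      using inj_onD[OF w] assms(3) j k by auto
    with x cv have "\<not> 2 \<le> local_degree (poly h) x"
      by (auto simp: critical_values_def)
    with poly_local_degree_pos[OF deg, of x] have "local_degree (poly h) x = 1"
      by simp
    then show ?thesis
      using mem_fibre_partition[of "poly h" "w k" x "local_degree (poly h)"]
        finite_poly_fibre[OF deg] x by simp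
  qed
  have "\<forall>k\<in>I. add_mset 1 (if k = i then {#p#} else {#}) \<subseteq># ?\<Phi> (w k)"
    using at_i at_j elsewhere by auto
  then show "\<exists>g. 1 \<le> degree g
      \<and> critical_values (local_degree (poly g)) (poly g) \<subseteq> w ` I
      \<and> (\<forall>k\<in>I. add_mset 1 (if k = i then {#p#} else {#})
           \<subseteq># fibre_partition (local_degree (poly g)) (poly g) (w k))"
    using deg cv assms(3) j(1) by (intro exI[of _ h]) auto
qed

text \<open>The single parts generate all lists of partitions under addition.\<close>
theorem realizable_partitions:
  assumes "finite I" "2 \<le> card I" "\<And>i. i \<in> I \<Longrightarrow> is_partition (A i)"
  shows "realizable I A"
proof -
  have one: "realizable I (\<lambda>k. if k = i then P else {#})"
    if "i \<in> I" "is_partition P" for i P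
    using that(2)
  proof (induction P)
    case empty
    then show ?case by (simp add: realizable_empty)
  next
    case (add p P)
    have "realizable I (\<lambda>k. (if k = i then {#p#} else {#}) + (if k = i then P else {#}))"
      using add that(1) assms(1,2)
      by (intro realizable_add realizable_single) (auto simp: is_partition_def)
    then show ?case
      by (rule realizable_cong[THEN iffD1, rotated]) auto
  qed
  have "realizable I (\<lambda>k. if k \<in> J then A k else {#})" if "J \<subseteq> I" for J
    using finite_subset[OF that assms(1)] that
  proof (induction J)
    case empty
    then show ?case by (simp add: realizable_empty)
  next
    case (insert i J)
    have "realizable I (\<lambda>k. (if k = i then A i else {#}) + (if k \<in> J then A k else {#}))"
      using insert assms(3) by (intro realizable_add one) auto
    then show ?case
      by (rule realizable_cong[THEN iffD1, rotated]) (use insert in auto)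
  qed
  from this[of I] show ?thesis
    by (rule realizable_cong[THEN iffD1, rotated]) auto
qed

section \<open>Quotients of polynomials as maps of the sphere\<close>

lemma coprime_polyI:
  fixes p q :: "complex poly"
  assumes "\<And>x. poly p x = 0 \<Longrightarrow> poly q x \<noteq> 0"
  shows "coprime p q"
proof (rule coprimeI)
  fix c assume c: "c dvd p" "c dvd q"
  have "degree c = 0"
  proof (rule ccontr)
    assume "degree c \<noteq> 0"
    then obtain x where "poly c x = 0"
      using poly_surj[of c 0] by auto
    then have "poly p x = 0" "poly q x = 0"
      using c by (auto elim!: dvdE)
    then show False
      using assms by blast
  qed
  moreover have "c \<noteq> 0"
    using c assms[of 0] by auto
  ultimately show "is_unit c"
    by (simp add: is_unit_iff_degree)
qed

lemma coprime_not_proportional: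
  fixes p q :: "complex poly"
  assumes "coprime p q" "1 \<le> max (degree p) (degree q)"
  shows "q \<noteq> 0" "p - smult c q \<noteq> 0"
proof -
  show "q \<noteq> 0"
  proof
    assume "q = 0"
    with assms have "is_unit p" "p \<noteq> 0" "degree p \<noteq> 0"
      by auto
    then show False
      by (simp add: is_unit_iff_degree)
  qed
  show "p - smult c q \<noteq> 0"
  proof
    assume "p - smult c q = 0"
    then have p: "p = smult c q" by simp
    then have "q dvd p" by (simp add: dvd_smult)
    with assms(1) have "is_unit q"
      by (metis coprime_common_divisor dvd_refl)
    then have "degree q = 0"
      using \<open>q \<noteq> 0\<close> by (simp add: is_unit_iff_degree)
    then show False
      using assms(2) p by (simp add: degree_smult_eq split: if_splits)
  qed
qed

lemma coprime_no_common_root: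
  fixes p q :: "complex poly"
  assumes "coprime p q" "poly q x = 0"
  shows "poly p x \<noteq> 0"
proof
  assume "poly p x = 0"
  then have "[:- x, 1:] dvd p" "[:- x, 1:] dvd q"
    using assms(2) by (simp_all add: poly_eq_0_iff_dvd)
  with assms(1) have "is_unit [:- x, 1:]"
    by (rule coprime_common_divisor)
  then show False
    by (simp add: is_unit_iff_degree)
qed

lemma quotient_locally_nonconstant:
  fixes p q :: "complex poly"
  assumes "coprime p q" "1 \<le> max (degree p) (degree q)"
  shows "\<forall>\<^sub>F z in at x. poly p z / poly q z \<noteq> c"
proof -
  note nz = coprime_not_proportional[OF assms]
  have "finite ({z. poly q z = 0} \<union> {z. poly (p - smult c q) z = 0})"
    using nz by (simp only: finite_Un poly_roots_finite simp_thms)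
  from eventually_at_not_in_finite[OF this, of x] show ?thesis
    by eventually_elim (auto simp: field_simps)
qed

lemma quotient_analytic:
  fixes p q :: "complex poly"
  shows "poly q x \<noteq> 0 \<Longrightarrow> (\<lambda>z. poly p z / poly q z) analytic_on {x}"
  by (intro analytic_on_divide analytic_on_poly) simp

lemma mult_quotient_map_Fin:
  "mult (quotient_map p q) (Fin x) =
     (if poly q x = 0 then local_degree (\<lambda>z. poly q z / poly p z) x
      else local_degree (\<lambda>z. poly p z / poly q z) x)"
proof -
  have "affine_coord (quotient_map p q (Fin z)) = poly p z / poly q z" for z
    by simp
  moreover have "affine_coord (sphere_inverse (quotient_map p q (Fin z))) = poly q z / poly p z"
    for z
    by simp
  ultimately show ?thesis
    by (simp only: mult.simps) simp
qed

lemma mult_quotient_map_Fin_pos: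
  assumes "coprime p q" "1 \<le> max (degree p) (degree q)"
  shows "0 < mult (quotient_map p q) (Fin x)"
  unfolding mult_quotient_map_Fin
  using assms coprime_no_common_root[OF assms(1), of x]
  by (auto intro!: local_degree_pos quotient_analytic quotient_locally_nonconstant
      simp: coprime_commute max.commute)

lemma mult_quotient_map_compose:
  assumes "coprime p q" "1 \<le> max (degree p) (degree q)" "1 \<le> degree g"
  shows "mult (quotient_map (pcompose p g) (pcompose q g)) (Fin x)
       = mult (quotient_map p q) (Fin (poly g x)) * local_degree (poly g) x"
proof -
  have comp: "local_degree (\<lambda>z. poly r (poly g z) / poly s (poly g z)) x
      = local_degree (\<lambda>u. poly r u / poly s u) (poly g x) * local_degree (poly g) x"
    if "coprime r s" "1 \<le> max (degree r) (degree s)" "poly s (poly g x) \<noteq> 0" for r s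
    using that assms(3)
    by (intro local_degree_compose[of "poly g" x "\<lambda>u. poly r u / poly s u"]
        analytic_on_poly poly_locally_nonconstant quotient_analytic quotient_locally_nonconstant)
  show ?thesis
    unfolding mult_quotient_map_Fin poly_pcompose
    using comp[of p q] comp[of q p] assms coprime_no_common_root[OF assms(1), of "poly g x"]
    by (auto simp: coprime_commute max.commute)
qed

text \<open>When the quotient has a pole at infinity, its local expression there is
  \<open>q(1/z) / p(1/z) = z\<^sup>k \<cdot> (q\<^sup>* / p\<^sup>*)(z)\<close>, where \<open>p\<^sup>*\<close> and \<open>q\<^sup>*\<close> are the reflected polynomials, which
  do not vanish at \<open>0\<close>, and \<open>k = degree p - degree q\<close>.\<close>
lemma mult_quotient_map_Infty_pos:
  assumes "degree q < degree p" "q \<noteq> 0"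
  shows "0 < mult (quotient_map p q) Infty"
proof -
  have p: "p \<noteq> 0" "coeff q (degree p) = 0" "max (degree p) (degree q) = degree p"
    using assms by (auto simp: coeff_eq_0)
  define u where "u z = poly (reflect_poly q) z / poly (reflect_poly p) z" for z
  define Z where "Z z = affine_coord (sphere_inverse (quotient_map p q (sphere_inverse (Fin z))))"
    for z
  let ?S = "{z. poly (reflect_poly p) z \<noteq> 0}"
  have "zorder (\<lambda>z. Z z - Z 0) 0 = int (degree p - degree q)"
  proof (rule zorder_eqI)
    show "open ?S"
      by (intro open_Collect_neq continuous_intros)
    show "u holomorphic_on ?S"
      unfolding u_def
      by (intro holomorphic_intros analytic_imp_holomorphic[OF analytic_on_poly]) auto
    show "0 \<in> ?S" "u 0 \<noteq> 0"
      using p assms(2) by (simp_all add: u_def)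
    fix z assume z: "z \<in> ?S" "z \<noteq> (0::complex)"
    have "Z z = poly q (inverse z) / poly p (inverse z)"
      using z(2) by (simp add: Z_def)
    also have "\<dots> = (poly (reflect_poly q) z / z ^ degree q) / (poly (reflect_poly p) z / z ^ degree p)"
      using z(2) by (simp add: poly_reflect_poly_nz)
    finally have "Z z = u z * (z ^ degree p / z ^ degree q)"
      by (simp add: u_def)
    moreover have "z ^ degree p = z ^ (degree p - degree q) * z ^ degree q"
      using assms(1) by (simp flip: power_add)
    ultimately have "Z z = u z * z ^ (degree p - degree q)"
      using z(2) by simp
    moreover have "Z 0 = 0"
      using p by (simp add: Z_def)
    ultimately show "Z z - Z 0 = u z * (z - 0) powi int (degree p - degree q)"
      by simp
  qed
  moreover have "mult (quotient_map p q) Infty = local_degree Z 0"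
    using p by (simp add: Z_def[abs_def])
  ultimately show ?thesis
    using assms(1) by (simp add: local_degree_def)
qed

lemma finite_quotient_map_fibre:
  assumes "coprime p q" "1 \<le> max (degree p) (degree q)"
  shows "finite {x. quotient_map p q x = y}"
proof -
  let ?Z = "{z. poly q z = 0} \<union> {z. poly (p - smult (affine_coord y) q) z = 0}"
  have "finite ?Z"
    using coprime_not_proportional[OF assms] by (simp only: finite_Un poly_roots_finite simp_thms)
  moreover have "{x. quotient_map p q x = y} \<subseteq> insert Infty (Fin ` ?Z)"
  proof
    fix x assume x: "x \<in> {x. quotient_map p q x = y}"
    show "x \<in> insert Infty (Fin ` ?Z)"
      using x by (cases x) (auto simp: field_simps split: if_splits)
  qed
  ultimately show ?thesis
    by (meson finite.insertI finite_imageI finite_subset)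
qed

section \<open>A quartic map with three unramified points over its critical values\<close>

definition quartic_num :: "complex poly" where "quartic_num = [:0, 0, 0, - 2, 1:]"
definition quartic_den :: "complex poly" where "quartic_den = [:1, - 2:]"

abbreviation quartic_map :: "riemann_sphere \<Rightarrow> riemann_sphere" where
  "quartic_map \<equiv> quotient_map quartic_num quartic_den"

lemma poly_quartic:
  "poly quartic_num x = x ^ 3 * (x - 2)" "poly quartic_den x = 1 - 2 * x"
  by (simp_all add: quartic_num_def quartic_den_def eval_nat_numeral algebra_simps)

lemma degree_quartic: "degree quartic_num = 4" "degree quartic_den = 1"
  by (simp_all add: quartic_num_def quartic_den_def)

lemma coprime_quartic: "coprime quartic_num quartic_den"
  by (rule coprime_polyI) (auto simp: poly_quartic)

lemma quartic_map_simps: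
  "quartic_map (Fin 0) = Fin 0" "quartic_map (Fin 2) = Fin 0"
  "quartic_map (Fin 1) = Fin 1" "quartic_map (Fin (- 1)) = Fin 1"
  "quartic_map (Fin (1 / 2)) = Infty"
  by (simp_all add: poly_quartic)

text \<open>The derivative of the map is \<open>- 6 x\<^sup>2 (x - 1)\<^sup>2 / (1 - 2 x)\<^sup>2\<close>. At the pole \<open>1/2\<close> the reciprocal
  has to be differentiated, which gives the same numerator up to sign.\<close>
lemma mult_quartic_map:
  assumes "u \<noteq> 0" "u \<noteq> 1"
  shows "mult quartic_map (Fin u) = 1"
proof -
  let ?N = "\<lambda>z. poly quartic_num z" and ?D = "\<lambda>z. poly quartic_den z"
  have N': "(?N has_field_derivative 4 * u ^ 3 - 6 * u ^ 2) (at u)"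
    by (auto simp: poly_quartic[abs_def] intro!: derivative_eq_intros) algebra
  have D': "(?D has_field_derivative - 2) (at u)"
    by (auto simp: poly_quartic[abs_def] intro!: derivative_eq_intros)
  have W: "(4 * u ^ 3 - 6 * u ^ 2) * ?D u - ?N u * - 2 = - 6 * u ^ 2 * (u - 1) ^ 2"
    unfolding poly_quartic by algebra
  have W': "- 2 * ?N u - ?D u * (4 * u ^ 3 - 6 * u ^ 2) = 6 * u ^ 2 * (u - 1) ^ 2"
    unfolding poly_quartic by algebra
  show ?thesis
  proof (cases "?D u = 0")
    case True
    then have nz: "?N u \<noteq> 0"
      by (rule coprime_no_common_root[OF coprime_quartic])
    have "local_degree (\<lambda>z. ?D z / ?N z) u = 1"
    proof (rule local_degree_eq_1[OF quotient_analytic[OF nz] DERIV_divide[OF D' N' nz]])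
      show "(- 2 * ?N u - ?D u * (4 * u ^ 3 - 6 * u ^ 2)) / (?N u * ?N u) \<noteq> 0"
        unfolding W' using assms nz by simp
    qed
    then show ?thesis
      using True by (simp add: mult_quotient_map_Fin del: mult.simps)
  next
    case False
    have "local_degree (\<lambda>z. ?N z / ?D z) u = 1"
    proof (rule local_degree_eq_1[OF quotient_analytic[OF False] DERIV_divide[OF N' D' False]])
      show "((4 * u ^ 3 - 6 * u ^ 2) * ?D u - ?N u * - 2) / (?D u * ?D u) \<noteq> 0"
        unfolding W using assms False by simp
    qed
    then show ?thesis
      using False by (simp add: mult_quotient_map_Fin del: mult.simps)
  qed
qed

lemma quartic_map_surj_Fin:
  obtains z where "quartic_map (Fin z) = Fin c"
proof -
  have "degree (quartic_num + - smult c quartic_den) = degree quartic_num"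
    by (intro degree_add_eq_left) (simp add: degree_quartic)
  then obtain z where z: "poly (quartic_num + - smult c quartic_den) z = 0"
    using poly_surj[of "quartic_num + - smult c quartic_den" 0] by (auto simp: degree_quartic)
  then have "poly quartic_den z \<noteq> 0"
    using coprime_no_common_root[OF coprime_quartic, of z] by auto
  then show ?thesis
    using z that[of z] by (simp add: field_simps)
qed

text \<open>The values \<open>v i\<close> are \<open>0, 1, \<infinity>, 3, 4, \<dots>\<close>. Over the three critical ones take the unramified
  points \<open>2, -1, 1/2\<close>; over the other values every point is unramified.\<close>
lemma quartic_map_configuration:
  "\<exists>(v :: nat \<Rightarrow> riemann_sphere) (a :: nat \<Rightarrow> complex).
     inj v \<and> {Fin 0, Fin 1, Infty} = v ` {..<3}
   \<and> (\<forall>i. quartic_map (Fin (a i)) = v i) \<and> (\<forall>i. mult quartic_map (Fin (a i)) = 1)"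
proof -
  define v :: "nat \<Rightarrow> riemann_sphere" where "v i = (if i = 2 then Infty else Fin (of_nat i))" for i
  have "\<exists>z. quartic_map (Fin z) = v i \<and> z \<noteq> 0 \<and> z \<noteq> 1" for i
  proof -
    consider "i = 0" | "i = 1" | "i = 2" | "3 \<le> i"
      by linarith
    then show ?thesis
    proof cases
      case 1
      then show ?thesis
        by (intro exI[of _ 2]) (simp add: v_def quartic_map_simps del: quotient_map.simps)
    next
      case 2
      then show ?thesis
        by (intro exI[of _ "- 1"]) (simp add: v_def quartic_map_simps del: quotient_map.simps)
    next
      case 3
      then show ?thesis
        by (intro exI[of _ "1 / 2"]) (simp add: v_def quartic_map_simps del: quotient_map.simps)
    next
      case 4
      obtain z where z: "quartic_map (Fin z) = Fin (of_nat i)"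
        by (rule quartic_map_surj_Fin)
      then have "z \<noteq> 0" "z \<noteq> 1"
        using 4 quartic_map_simps(1,3) by (auto simp del: quotient_map.simps)
      then show ?thesis
        using z 4 by (intro exI[of _ z]) (simp add: v_def del: quotient_map.simps)
    qed
  qed
  then obtain a where a: "\<And>i. quartic_map (Fin (a i)) = v i" "\<And>i. a i \<noteq> 0" "\<And>i. a i \<noteq> 1"
    by metis
  have "inj v"
    by (auto simp: inj_on_def v_def split: if_splits)
  moreover have "{Fin 0, Fin 1, Infty} = v ` {..<3}"
    by (simp add: v_def lessThan_Suc eval_nat_numeral insert_commute)
  ultimately show ?thesis
    using a mult_quartic_map by blast
qed

section \<open>Extension to passports\<close>

text \<open>Passports range over the exact set of critical values, while the constructions only bound this
  set from above. The additional part 2 over each \<open>v i\<close> closes the gap.\<close>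
lemma list_extends_passport:
  assumes v: "inj_on v {..<length Ps}"
    and cv: "critical_values \<mu> f \<subseteq> v ` {..<length Ps}"
    and fib: "\<And>i. i < length Ps \<Longrightarrow> add_mset 2 (Ps ! i) \<subseteq># fibre_partition \<mu> f (v i)"
    and pos: "\<And>x. 0 < \<mu> x"
  shows "list_extends Ps (passport \<mu> f)"
proof -
  let ?n = "length Ps"
  have "v i \<in> critical_values \<mu> f" if "i < ?n" for i
  proof -
    have "2 \<in># fibre_partition \<mu> f (v i)"
      using mset_subset_eqD[OF fib[OF that]] by simp
    then obtain x where "f x = v i" "\<mu> x = 2"
      by (rule mem_fibre_partitionE)
    then show ?thesis
      unfolding critical_values_def by (intro image_eqI[of _ f x]) auto
  qed
  with cv have "critical_values \<mu> f = v ` {..<?n}"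
    by auto
  then have "passport \<mu> f = image_mset (\<lambda>i. fibre_partition \<mu> f (v i)) (mset_set {..<?n})"
    by (simp add: passport_def multiset.map_comp o_def flip: image_mset_mset_set[OF v])
  also have "\<dots> = mset (map (\<lambda>i. fibre_partition \<mu> f (v i)) [0..<?n])"
    by (simp add: lessThan_atLeast0)
  finally have "mset (map (\<lambda>i. fibre_partition \<mu> f (v i)) [0..<?n]) = passport \<mu> f" ..
  moreover have "extends (Ps ! i) (fibre_partition \<mu> f (v i))" if "i < ?n" for i
  proof -
    let ?Q = "fibre_partition \<mu> f (v i)"
    have "Ps ! i \<subseteq># ?Q"
      using fib[OF that] by (rule subset_mset.order_trans[rotated]) simp
    moreover have "is_partition (?Q - Ps ! i)"
      unfolding is_partition_def
      using pos by (auto dest!: in_diffD elim!: mem_fibre_partitionE)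
    ultimately show ?thesis
      unfolding extends_def by (intro exI[of _ "?Q - Ps ! i"]) simp
  qed
  ultimately show ?thesis
    unfolding list_extends_def
    by (intro exI[of _ "map (\<lambda>i. fibre_partition \<mu> f (v i)) [0..<?n]"])
      (simp add: list_all2_conv_all_nth)
qed

theorem theorem5p1:
  fixes Ps :: "nat multiset list"
  assumes "\<forall>P\<in>set Ps. is_partition P"
  shows "(2 \<le> length Ps \<longrightarrow>
            (\<exists>g :: complex poly. 1 \<le> degree g \<and> list_extends Ps (poly_passport g)))
       \<and> (3 \<le> length Ps \<longrightarrow>
            (\<exists>f. rational_map f \<and> list_extends Ps (rational_passport f)))"
proof -
  let ?I = "{..<length Ps}"
  \<comment> \<open>The part 2 makes every prescribed point a critical value, even when \<open>Ps ! i\<close> is trivial.\<close>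
  define A where "A i = add_mset 2 (Ps ! i)" for i
  have "realizable ?I A" if "2 \<le> length Ps"
    using assms that by (intro realizable_partitions) (auto simp: A_def is_partition_def)
  then have ex: "\<exists>g. 1 \<le> degree g
      \<and> critical_values (local_degree (poly g)) (poly g) \<subseteq> w ` ?I
      \<and> (\<forall>i\<in>?I. A i \<subseteq># fibre_partition (local_degree (poly g)) (poly g) (w i))"
    if "2 \<le> length Ps" "inj_on w ?I" for w
    using that unfolding realizable_def by (meson mset_subset_eq_insertD subset_mset.less_imp_le)
  show ?thesis
  proof (intro conjI impI)
    assume "2 \<le> length Ps"
    moreover have inj: "inj_on (of_nat :: nat \<Rightarrow> complex) ?I"
      by (simp add: inj_on_def)
    ultimately obtain g where g: "1 \<le> degree g"
      "critical_values (local_degree (poly g)) (poly g) \<subseteq> of_nat ` ?I"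
      "\<And>i. i \<in> ?I \<Longrightarrow> A i \<subseteq># fibre_partition (local_degree (poly g)) (poly g) (of_nat i)"
      using ex[of of_nat] by blast
    have "list_extends Ps (poly_passport g)"
      unfolding poly_passport_def using g poly_local_degree_pos
      by (intro list_extends_passport[OF inj]) (auto simp: A_def)
    then show "\<exists>g :: complex poly. 1 \<le> degree g \<and> list_extends Ps (poly_passport g)"
      using g(1) by blast
  next
    assume n: "3 \<le> length Ps"
    obtain v :: "nat \<Rightarrow> riemann_sphere" and a :: "nat \<Rightarrow> complex"
      where v: "inj v" "{Fin 0, Fin 1, Infty} = v ` {..<3}"
      and a: "\<And>i. quartic_map (Fin (a i)) = v i" "\<And>i. mult quartic_map (Fin (a i)) = 1"
      using quartic_map_configuration by metis
    have "inj_on a ?I"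
      by (metis a(1) inj_on_def injD v(1))
    then obtain g where g: "1 \<le> degree g"
      and gcv: "critical_values (local_degree (poly g)) (poly g) \<subseteq> a ` ?I"
      and gfib: "\<And>i. i \<in> ?I \<Longrightarrow> A i \<subseteq># fibre_partition (local_degree (poly g)) (poly g) (a i)"
      using ex[of a] n by auto
    let ?p = "pcompose quartic_num g" and ?q = "pcompose quartic_den g"
    let ?f = "quotient_map ?p ?q"
    have deg: "degree ?q < degree ?p" "1 \<le> max (degree ?p) (degree ?q)"
      using g by (simp_all add: degree_pcompose degree_quartic)
    have cop: "coprime ?p ?q"
      using coprime_no_common_root[OF coprime_quartic]
      by (intro coprime_polyI) (auto simp: poly_pcompose)
    have rat: "rational_map ?f"
      unfolding rational_map_def using cop deg by blast
    have f_Fin: "?f (Fin x) = quartic_map (Fin (poly g x))" for x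
      by (simp add: poly_pcompose)
    have f_Infty: "?f Infty = Infty"
      using deg(1) by (simp add: coeff_eq_0 Let_def max_def)
    have mult_Fin: "mult ?f (Fin x) = mult quartic_map (Fin (poly g x)) * local_degree (poly g) x" for x
      using g by (intro mult_quotient_map_compose coprime_quartic) (simp_all add: degree_quartic)
    have pos: "0 < mult ?f x" for x
      using mult_quotient_map_Fin_pos[OF cop deg(2)]
        mult_quotient_map_Infty_pos[OF deg(1)] coprime_not_proportional(1)[OF cop deg(2)]
      by (cases x) (simp_all del: mult.simps)
    \<comment> \<open>The values of the quartic map at its three critical points are allowed as critical values
      of the composition; the value at infinity also absorbs the ramification of \<open>g\<close> there.\<close>
    have base: "{Fin 0, Fin 1, Infty} \<subseteq> v ` ?I"
      unfolding v(2) using n by auto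
    have cv: "?f x \<in> v ` ?I" if x: "2 \<le> mult ?f x" for x
    proof (cases x)
      case Infty
      then show ?thesis using f_Infty base by simp
    next
      case (Fin z)
      consider "poly g z \<in> {0, 1}" | "2 \<le> local_degree (poly g) z"
        using x mult_Fin[of z] mult_quartic_map[of "poly g z"] Fin by fastforce
      then show ?thesis
      proof cases
        case 1
        then show ?thesis
          unfolding Fin f_Fin using base quartic_map_simps(1,3) by (auto simp del: quotient_map.simps)
      next
        case 2
        then have "poly g z \<in> a ` ?I"
          using gcv by (auto simp: critical_values_def)
        then show ?thesis
          unfolding Fin f_Fin using a(1) by (auto simp del: quotient_map.simps)
      qed
    qed
    have fib: "A i \<subseteq># fibre_partition (mult ?f) ?f (v i)" if i: "i < length Ps" for i
    proof -
      let ?G = "{x. poly g x = a i}"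
      have "finite ?G"
        by (rule finite_poly_fibre[OF g])
      have "fibre_partition (local_degree (poly g)) (poly g) (a i)
          = image_mset (mult ?f) (image_mset Fin (mset_set ?G))"
        unfolding fibre_partition_def multiset.map_comp
        using \<open>finite ?G\<close> mult_Fin a(2) by (intro image_mset_cong) (simp del: mult.simps)
      also have "\<dots> = image_mset (mult ?f) (mset_set (Fin ` ?G))"
        by (subst image_mset_mset_set) (auto simp: inj_on_def)
      also have "\<dots> \<subseteq># image_mset (mult ?f) (mset_set {x. ?f x = v i})"
        using finite_quotient_map_fibre[OF cop deg(2)] f_Fin a(1)
        by (intro image_mset_set_mono) (auto simp del: quotient_map.simps)
      finally show ?thesis
        using gfib[of i] i by (auto simp: fibre_partition_def)
    qed
    have "list_extends Ps (rational_passport ?f)"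
      unfolding rational_passport_def
    proof (rule list_extends_passport)
      show "inj_on v ?I"
        using v(1) by (rule inj_on_subset) simp
      show "critical_values (mult ?f) ?f \<subseteq> v ` ?I"
        using cv by (auto simp: critical_values_def simp del: quotient_map.simps mult.simps)
    qed (use pos fib in \<open>simp_all add: A_def\<close>)
    then show "\<exists>f. rational_map f \<and> list_extends Ps (rational_passport f)"
      using rat by blast
  qed
qed

end
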